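(* Let $(V,\rho)$ be an LA-representation of a Lie antialgebra $\mathfrak{a}=\mathfrak a_0\oplus\mathfrak a_1$ over $\mathbb K$. Define a linear map $\tilde\rho:\mathfrak{g}_{\mathfrak{a}}\to\mathrm{End}(V)$ on the adjoint Lie superalgebra $\mathfrak{g}_{\mathfrak{a}}$ by setting, for all $a,b\in\mathfrak{a}_1$, $$\tilde\rho(a):=\rho(a),\qquad \tilde\rho(a\odot b):=\tfrac12\big(\rho(a)\rho(b)+\rho(b)\rho(a)\big).$$ Then $\tilde\rho$ is (well defined and) a representation of $\mathfrak{g}_{\mathfrak{a}}$; with the normalization of representations used here, this means $$\tilde\rho([X,Y])=\tfrac12\big(\tilde\rho(X)\tilde\rho(Y)-(-1)^{\bar X\bar Y}\tilde\rho(Y)\tilde\rho(X)\big)$$ for all homogeneous $X,Y\in\mathfrak{g}_{\mathfrak{a}}$.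
   Context: $\mathbb{K}=\mathbb{R}$ or $\mathbb{C}$. A superalgebra is a (not necessarily associative) $\mathbb{Z}_2$-graded algebra $\mathfrak{a}=\mathfrak{a}_0\oplus\mathfrak{a}_1$; it is supercommutative if $a\cdot b=(-1)^{\bar a\bar b}b\cdot a$ for homogeneous $a,b$. A Lie antialgebra is a supercommutative superalgebra $\mathfrak{a}=\mathfrak{a}_0\oplus\mathfrak{a}_1$ such that, for all $x,x_i\in\mathfrak{a}_0$ and $y,y_i\in\mathfrak{a}_1$: (LA0) $x_1(x_2x_3)=(x_1x_2)x_3$; (LA1) $x_1(x_2y)=\frac12(x_1x_2)y$; (LA2) $x(y_1y_2)=(xy_1)y_2+y_1(xy_2)$; (LA3) $y_1(y_2y_3)+y_2(y_3y_1)+y_3(y_1y_2)=0$. An LA-representation of $\mathfrak{a}$ is a $\mathbb{Z}_2$-graded vector space $V$ with an even linear map $\rho:\mathfrak{a}\to\mathrm{End}(V)$ such that $\rho(ab)=\frac12\big(\rho(a)\rho(b)+(-1)^{\bar a\bar b}\rho(b)\rho(a)\big)$ for all homogeneous $a,b\in\mathfrak{a}$, and $\rho(x)\rho(y)=\rho(y)\rho(x)$ for all $x,y\in\mathfrak{a}_0$. Adjoint Lie superalgebra: $(\mathfrak{g}_{\mathfrak{a}})_1:=\mathfrak{a}_1$, $(\mathfrak{g}_{\mathfrak{a}})_0:=(\mathfrak{a}_1\otimes\mathfrak{a}_1)/\mathcal{S}$, where $\mathcal{S}$ is the linear subspace spanned by $\{a\otimes b-b\otimes a,\ ax\otimes b-a\otimes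 bx : a,b\in\mathfrak{a}_1,\ x\in\mathfrak{a}_0\}$; $a\odot b$ is the class of $a\otimes b$. The bracket is $[a,b]=a\odot b$, $[a\odot b,c]=-[c,a\odot b]=a(bc)+b(ac)$, $[a\odot b,c\odot d]=2a(bc)\odot d+2b(ad)\odot c$, for $a,b,c,d\in\mathfrak{a}_1$; this is a Lie superalgebra. Normalization: the enveloping algebra $\mathcal{U}(\mathfrak{g})$ of a Lie superalgebra is taken to be the tensor algebra modulo the relations $\frac12(x\otimes y-(-1)^{\bar x\bar y}y\otimes x)=[x,y]$, and representations of $\mathfrak{g}$ are understood accordingly, i.e. $[x,y]$ acts as one half of the supercommutator of the actions of $x$ and $y$. *)

theory Defs
  imports Complex_Main "HOL-Library.Poly_Mapping" "HOL-Library.Z2"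
begin

text \<open>Fields isomorphic to the real or to the complex numbers.\<close>

class real_or_complex = field +
  assumes real_or_complex:
    "(\<exists>f :: 'a \<Rightarrow> real. bij f \<and> f 1 = 1 \<and>
        (\<forall>x y. f (x + y) = f x + f y \<and> f (x * y) = f x * f y)) \<or>
     (\<exists>f :: 'a \<Rightarrow> complex. bij f \<and> f 1 = 1 \<and>
        (\<forall>x y. f (x + y) = f x + f y \<and> f (x * y) = f x * f y))"

instance real :: real_or_complex
  by standard (rule disjI1, rule exI[of _ id], simp)

instance complex :: real_or_complex
  by standard (rule disjI2, rule exI[of _ id], simp)

lemma two_neq_0_of_hom:
  fixes f :: "'k::field \<Rightarrow> 'c::field_char_0"
  assumes "f 1 = 1" and "\<forall>x y. f (x + y) = f x + f y \<and> f (x * y) = f x * f y"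
  shows "(2 :: 'k) \<noteq> 0"
proof
  assume eq: "(2 :: 'k) = 0"
  have "f 0 = 0"
    using assms(2)[rule_format, of 0 0] by simp
  moreover have "f 2 = 2"
    using assms(2)[rule_format, of 1 1] assms(1) by simp
  ultimately show False
    using eq by simp
qed

lemma real_or_complex_two_neq_0: "(2 :: 'k::real_or_complex) \<noteq> 0"
  using real_or_complex[where ?'a = 'k] by (elim disjE exE conjE) (erule (1) two_neq_0_of_hom)+

definition koszul :: "bit \<Rightarrow> bit \<Rightarrow> 'k::field" where
  "koszul i j = (if i = 1 \<and> j = 1 then - 1 else 1)"

locale superspace = vector_space scale
  for scale :: "'k::real_or_complex \<Rightarrow> 'v::ab_group_add \<Rightarrow> 'v" (infixr \<open>*s\<close> 75) +
  fixes gr :: "bit \<Rightarrow> 'v set"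
  assumes subspace_gr: "subspace (gr i)"
    and gr_inter: "gr 0 \<inter> gr 1 = {0}"
    and gr_sum: "\<exists>u \<in> gr 0. \<exists>w \<in> gr 1. v = u + w"

locale superalgebra = superspace scale gr
  for scale :: "'k::real_or_complex \<Rightarrow> 'a::ab_group_add \<Rightarrow> 'a" (infixr \<open>*s\<close> 75)
    and mul :: "'a \<Rightarrow> 'a \<Rightarrow> 'a" (infixl \<open>\<cdot>\<close> 70)
    and gr :: "bit \<Rightarrow> 'a set" +
  assumes linear_mul_left: "Vector_Spaces.linear scale scale (\<lambda>a. a \<cdot> b)"
    and linear_mul_right: "Vector_Spaces.linear scale scale (\<lambda>b. a \<cdot> b)"
    and mul_gr: "a \<in> gr i \<Longrightarrow> b \<in> gr j \<Longrightarrow> a \<cdot> b \<in> gr (i + j)"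

locale lie_antialgebra = superalgebra scale mul gr
  for scale :: "'k::real_or_complex \<Rightarrow> 'a::ab_group_add \<Rightarrow> 'a" (infixr \<open>*s\<close> 75)
    and mul :: "'a \<Rightarrow> 'a \<Rightarrow> 'a" (infixl \<open>\<cdot>\<close> 70)
    and gr :: "bit \<Rightarrow> 'a set" +
  assumes supercomm: "a \<in> gr i \<Longrightarrow> b \<in> gr j \<Longrightarrow> a \<cdot> b = koszul i j *s (b \<cdot> a)"
    and LA0: "x1 \<in> gr 0 \<Longrightarrow> x2 \<in> gr 0 \<Longrightarrow> x3 \<in> gr 0 \<Longrightarrow> x1 \<cdot> (x2 \<cdot> x3) = (x1 \<cdot> x2) \<cdot> x3"
    and LA1: "x1 \<in> gr 0 \<Longrightarrow> x2 \<in> gr 0 \<Longrightarrow> y \<in> gr 1 \<Longrightarrow>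
      x1 \<cdot> (x2 \<cdot> y) = (1/2) *s ((x1 \<cdot> x2) \<cdot> y)"
    and LA2: "x \<in> gr 0 \<Longrightarrow> y1 \<in> gr 1 \<Longrightarrow> y2 \<in> gr 1 \<Longrightarrow>
      x \<cdot> (y1 \<cdot> y2) = (x \<cdot> y1) \<cdot> y2 + y1 \<cdot> (x \<cdot> y2)"
    and LA3: "y1 \<in> gr 1 \<Longrightarrow> y2 \<in> gr 1 \<Longrightarrow> y3 \<in> gr 1 \<Longrightarrow>
      y1 \<cdot> (y2 \<cdot> y3) + y2 \<cdot> (y3 \<cdot> y1) + y3 \<cdot> (y1 \<cdot> y2) = 0"

locale LA_representation =
  A: lie_antialgebra scaleA mul grA + V: superspace scaleV grV
  for scaleA :: "'k::real_or_complex \<Rightarrow> 'a::ab_group_add \<Rightarrow> 'a"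
    and mul :: "'a \<Rightarrow> 'a \<Rightarrow> 'a"
    and grA :: "bit \<Rightarrow> 'a set"
    and scaleV :: "'k \<Rightarrow> 'v::ab_group_add \<Rightarrow> 'v"
    and grV :: "bit \<Rightarrow> 'v set" +
  fixes \<rho> :: "'a \<Rightarrow> 'v \<Rightarrow> 'v"
  assumes rho_End: "Vector_Spaces.linear scaleV scaleV (\<rho> a)"
    and rho_linear: "Vector_Spaces.linear scaleA scaleV (\<lambda>a. \<rho> a v)"
    and rho_even: "a \<in> grA i \<Longrightarrow> v \<in> grV j \<Longrightarrow> \<rho> a v \<in> grV (i + j)"
    and rho_mul: "a \<in> grA i \<Longrightarrow> b \<in> grA j \<Longrightarrow>
      \<rho> (mul a b) v = scaleV (1/2) (\<rho> a (\<rho> b v) + scaleV (koszul i j) (\<rho> b (\<rho> a v)))"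
    and rho_comm: "x \<in> grA 0 \<Longrightarrow> y \<in> grA 0 \<Longrightarrow> \<rho> x (\<rho> y v) = \<rho> y (\<rho> x v)"

record ('k, 'g) lie_superalgebra_data =
  homog :: "bit \<Rightarrow> 'g set"
  lcarrier :: "'g set"
  ladd :: "'g \<Rightarrow> 'g \<Rightarrow> 'g"
  lscale :: "'k \<Rightarrow> 'g \<Rightarrow> 'g"
  lbracket :: "'g \<Rightarrow> 'g \<Rightarrow> 'g"

definition linear_to_End ::
  "('k::real_or_complex, 'g) lie_superalgebra_data \<Rightarrow> ('k \<Rightarrow> 'v::ab_group_add \<Rightarrow> 'v) \<Rightarrow>
    ('g \<Rightarrow> 'v \<Rightarrow> 'v) \<Rightarrow> bool" where
  "linear_to_End L scaleV \<phi> \<longleftrightarrow>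
    (\<forall>X \<in> lcarrier L. Vector_Spaces.linear scaleV scaleV (\<phi> X)) \<and>
    (\<forall>X \<in> lcarrier L. \<forall>Y \<in> lcarrier L. \<forall>v. \<phi> (ladd L X Y) v = \<phi> X v + \<phi> Y v) \<and>
    (\<forall>c. \<forall>X \<in> lcarrier L. \<forall>v. \<phi> (lscale L c X) v = scaleV c (\<phi> X v))"

text \<open>The factor 1/2 below is the normalization of the enveloping algebra in which the bracket is
  half of the supercommutator.\<close>

definition lie_superalgebra_rep ::
  "('k::real_or_complex, 'g) lie_superalgebra_data \<Rightarrow> ('k \<Rightarrow> 'v::ab_group_add \<Rightarrow> 'v) \<Rightarrow>
    (bit \<Rightarrow> 'v set) \<Rightarrow> ('g \<Rightarrow> 'v \<Rightarrow> 'v) \<Rightarrow> bool" where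
  "lie_superalgebra_rep L scaleV grV \<phi> \<longleftrightarrow>
    superspace scaleV grV \<and> linear_to_End L scaleV \<phi> \<and>
    (\<forall>i j. \<forall>X \<in> homog L i. \<forall>v \<in> grV j. \<phi> X v \<in> grV (i + j)) \<and>
    (\<forall>i j. \<forall>X \<in> homog L i. \<forall>Y \<in> homog L j. \<forall>v.
      \<phi> (lbracket L X Y) v =
        scaleV (1/2) (\<phi> X (\<phi> Y v) - scaleV (koszul i j) (\<phi> Y (\<phi> X v))))"

text \<open>The free vector space on a type of symbols, with linear extension of maps from the symbols.\<close>

definition fscale :: "'k::field \<Rightarrow> ('p \<Rightarrow>\<^sub>0 'k) \<Rightarrow> ('p \<Rightarrow>\<^sub>0 'k)" where
  "fscale c = Poly_Mapping.map ((*) c)"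

definition fext :: "('k::field \<Rightarrow> 'w::ab_group_add \<Rightarrow> 'w) \<Rightarrow> ('p \<Rightarrow> 'w) \<Rightarrow> ('p \<Rightarrow>\<^sub>0 'k) \<Rightarrow> 'w" where
  "fext s h u = (\<Sum>p \<in> Poly_Mapping.keys u. s (Poly_Mapping.lookup u p) (h p))"

definition symb :: "'a \<Rightarrow> 'a \<Rightarrow> (('a \<times> 'a) \<Rightarrow>\<^sub>0 'k::field)" where
  "symb a b = Poly_Mapping.single (a, b) 1"

context lie_antialgebra
begin

definition free_odd :: "(('a \<times> 'a) \<Rightarrow>\<^sub>0 'k) set" where
  "free_odd = {u. Poly_Mapping.keys u \<subseteq> gr 1 \<times> gr 1}"

definition tensor_rels :: "(('a \<times> 'a) \<Rightarrow>\<^sub>0 'k) set" where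
  "tensor_rels =
    {symb (a + a') b - symb a b - symb a' b | a a' b. a \<in> gr 1 \<and> a' \<in> gr 1 \<and> b \<in> gr 1} \<union>
    {symb a (b + b') - symb a b - symb a b' | a b b'. a \<in> gr 1 \<and> b \<in> gr 1 \<and> b' \<in> gr 1} \<union>
    {symb (c *s a) b - fscale c (symb a b) | c a b. a \<in> gr 1 \<and> b \<in> gr 1} \<union>
    {symb a (c *s b) - fscale c (symb a b) | c a b. a \<in> gr 1 \<and> b \<in> gr 1}"

definition S_rels :: "(('a \<times> 'a) \<Rightarrow>\<^sub>0 'k) set" where
  "S_rels =
    {symb a b - symb b a | a b. a \<in> gr 1 \<and> b \<in> gr 1} \<union>
    {symb (a \<cdot> x) b - symb a (b \<cdot> x) | a b x. a \<in> gr 1 \<and> b \<in> gr 1 \<and> x \<in> gr 0}"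

text \<open>\<open>free_odd\<close> modulo the span of \<open>tensor_rels\<close> is the tensor square of the odd part; its
  quotient by the image of the span of \<open>S_rels\<close> is \<open>free_odd\<close> modulo the span of both.\<close>

definition adj_null :: "(('a \<times> 'a) \<Rightarrow>\<^sub>0 'k) set" where
  "adj_null = module.span fscale (tensor_rels \<union> S_rels)"

definition adj_rel :: "((('a \<times> 'a) \<Rightarrow>\<^sub>0 'k) \<times> (('a \<times> 'a) \<Rightarrow>\<^sub>0 'k)) set" where
  "adj_rel = {(u, v). u \<in> free_odd \<and> v \<in> free_odd \<and> u - v \<in> adj_null}"

definition cls :: "(('a \<times> 'a) \<Rightarrow>\<^sub>0 'k) \<Rightarrow> (('a \<times> 'a) \<Rightarrow>\<^sub>0 'k) set" where
  "cls u = adj_rel `` {u}"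

definition adj_even :: "(('a \<times> 'a) \<Rightarrow>\<^sub>0 'k) set set" where
  "adj_even = free_odd // adj_rel"

definition adj_even_add where
  "adj_even_add X Y = (\<Union>u \<in> X. \<Union>v \<in> Y. cls (u + v))"

definition adj_even_scale where
  "adj_even_scale c X = (\<Union>u \<in> X. cls (fscale c u))"

definition act :: "(('a \<times> 'a) \<Rightarrow>\<^sub>0 'k) \<Rightarrow> 'a \<Rightarrow> 'a" where
  "act u c = fext scale (\<lambda>(a, b). a \<cdot> (b \<cdot> c) + b \<cdot> (a \<cdot> c)) u"

definition free_bracket ::
  "(('a \<times> 'a) \<Rightarrow>\<^sub>0 'k) \<Rightarrow> (('a \<times> 'a) \<Rightarrow>\<^sub>0 'k) \<Rightarrow> (('a \<times> 'a) \<Rightarrow>\<^sub>0 'k)" where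
  "free_bracket u v =
    fext fscale (\<lambda>(a, b). fext fscale (\<lambda>(c, d).
      fscale 2 (symb (a \<cdot> (b \<cdot> c)) d) + fscale 2 (symb (b \<cdot> (a \<cdot> d)) c)) v) u"

definition even_even :: "(('a \<times> 'a) \<Rightarrow>\<^sub>0 'k) set \<Rightarrow> (('a \<times> 'a) \<Rightarrow>\<^sub>0 'k) set \<Rightarrow> (('a \<times> 'a) \<Rightarrow>\<^sub>0 'k) set"
  where "even_even X Y = (\<Union>u \<in> X. \<Union>v \<in> Y. cls (free_bracket u v))"

definition even_odd :: "(('a \<times> 'a) \<Rightarrow>\<^sub>0 'k) set \<Rightarrow> 'a \<Rightarrow> 'a" where
  "even_odd X c = the_elem ((\<lambda>u. act u c) ` X)"

definition odd_elem :: "'a \<Rightarrow> (('a \<times> 'a) \<Rightarrow>\<^sub>0 'k) set \<times> 'a" where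
  "odd_elem a = (cls 0, a)"

definition odot :: "'a \<Rightarrow> 'a \<Rightarrow> (('a \<times> 'a) \<Rightarrow>\<^sub>0 'k) set \<times> 'a" where
  "odot a b = (cls (symb a b), 0)"

text \<open>A pair \<open>(X, y)\<close> stands for the sum of the even element \<open>X\<close> and the odd element \<open>y\<close>.\<close>

definition adjoint :: "('k, (('a \<times> 'a) \<Rightarrow>\<^sub>0 'k) set \<times> 'a) lie_superalgebra_data" where
  "adjoint =
    \<lparr>homog = (\<lambda>i. if i = 0 then adj_even \<times> {0} else {cls 0} \<times> gr 1),
     lcarrier = adj_even \<times> gr 1,
     ladd = (\<lambda>(X, y) (X', y'). (adj_even_add X X', y + y')),
     lscale = (\<lambda>c (X, y). (adj_even_scale c X, c *s y)),
     lbracket = (\<lambda>(X, y) (X', y').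
       (adj_even_add (even_even X X') (cls (symb y y')), even_odd X y' - even_odd X' y))\<rparr>"

end

lemma lookup_fscale [simp]: "Poly_Mapping.lookup (fscale c u) p = c * Poly_Mapping.lookup u p"
  by (simp add: fscale_def Poly_Mapping.map.rep_eq when_def)

interpretation free: vector_space fscale
  by standard (simp_all add: poly_mapping_eq_iff fun_eq_iff lookup_add algebra_simps)

lemma fscale_two: "fscale 2 u = u + u"
  using free.scale_left_distrib[of 1 1 u] by simp

lemma fext_superset:
  assumes "vector_space s" "finite K" "Poly_Mapping.keys u \<subseteq> K"
  shows "fext s h u = (\<Sum>p \<in> K. s (Poly_Mapping.lookup u p) (h p))"
proof -
  interpret vector_space s by fact
  show ?thesis
    unfolding fext_def using assms
    by (intro sum.mono_neutral_left) (auto simp: in_keys_iff)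
qed

lemma fext_add:
  assumes "vector_space s"
  shows "fext s h (u + v) = fext s h u + fext s h v"
proof -
  interpret vector_space s by fact
  let ?K = "Poly_Mapping.keys u \<union> Poly_Mapping.keys v"
  have "Poly_Mapping.keys (u + v) \<subseteq> ?K"
    by (rule keys_add)
  then show ?thesis
    by (simp add: fext_superset[OF assms, of ?K] lookup_add scale_left_distrib sum.distrib)
qed

lemma fext_scale:
  assumes "vector_space s"
  shows "fext s h (fscale c u) = s c (fext s h u)"
proof -
  interpret vector_space s by fact
  have "Poly_Mapping.keys (fscale c u) \<subseteq> Poly_Mapping.keys u"
    by (auto simp: in_keys_iff)
  then show ?thesis
    by (simp add: fext_superset[OF assms, of "Poly_Mapping.keys u"] scale_sum_right)
qed

lemma linear_fscaleI:
  assumes "vector_space s" "\<And>u v. h (u + v) = h u + h v" "\<And>c u. h (fscale c u) = s c (h u)"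
  shows "Vector_Spaces.linear fscale s h"
  using assms free.vector_space_axioms
  by (simp add: Vector_Spaces.linear_def module_hom_def module_hom_axioms_def module_iff_vector_space)

lemma fext_linear: "vector_space s \<Longrightarrow> Vector_Spaces.linear fscale s (fext s h)"
  by (simp add: linear_fscaleI fext_add fext_scale)

lemma fext_symb: "vector_space s \<Longrightarrow> fext s h (symb a b) = h (a, b)"
  by (simp add: fext_def symb_def vector_space.vector_space_assms(4))

context lie_antialgebra
begin

lemma odd_closed:
  "a \<in> gr i \<Longrightarrow> b \<in> gr i \<Longrightarrow> a + b \<in> gr i" "a \<in> gr i \<Longrightarrow> b \<in> gr i \<Longrightarrow> a - b \<in> gr i"
  "a \<in> gr i \<Longrightarrow> c *s a \<in> gr i" "a \<in> gr i \<Longrightarrow> - a \<in> gr i" "0 \<in> gr i"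
  using subspace_gr[of i]
  by (auto intro: subspace_add subspace_diff subspace_scale subspace_neg subspace_0)

lemma mul_closed:
  "a \<in> gr 1 \<Longrightarrow> b \<in> gr 1 \<Longrightarrow> a \<cdot> b \<in> gr 0"
  "a \<in> gr 1 \<Longrightarrow> x \<in> gr 0 \<Longrightarrow> a \<cdot> x \<in> gr 1"
  "x \<in> gr 0 \<Longrightarrow> a \<in> gr 1 \<Longrightarrow> x \<cdot> a \<in> gr 1"
  "x \<in> gr 0 \<Longrightarrow> x' \<in> gr 0 \<Longrightarrow> x \<cdot> x' \<in> gr 0"
  using mul_gr[of a 1 b 1] mul_gr[of a 1 x 0] mul_gr[of x 0 a 1] mul_gr[of x 0 x' 0] by auto

lemma mul_simps:
  "(a + a') \<cdot> b = a \<cdot> b + a' \<cdot> b" "b \<cdot> (a + a') = b \<cdot> a + b \<cdot> a'"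
  "(a - a') \<cdot> b = a \<cdot> b - a' \<cdot> b" "b \<cdot> (a - a') = b \<cdot> a - b \<cdot> a'"
  "(- a) \<cdot> b = - (a \<cdot> b)" "b \<cdot> (- a) = - (b \<cdot> a)"
  "(c *s a) \<cdot> b = c *s (a \<cdot> b)" "b \<cdot> (c *s a) = c *s (b \<cdot> a)"
  "0 \<cdot> b = 0" "b \<cdot> 0 = 0"
proof -
  interpret l: Vector_Spaces.linear scale scale "\<lambda>a. a \<cdot> b" by (rule linear_mul_left)
  interpret r: Vector_Spaces.linear scale scale "\<lambda>a. b \<cdot> a" by (rule linear_mul_right)
  show "(a + a') \<cdot> b = a \<cdot> b + a' \<cdot> b" "b \<cdot> (a + a') = b \<cdot> a + b \<cdot> a'"
    "(a - a') \<cdot> b = a \<cdot> b - a' \<cdot> b" "b \<cdot> (a - a') = b \<cdot> a - b \<cdot> a'"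
    "(- a) \<cdot> b = - (a \<cdot> b)" "b \<cdot> (- a) = - (b \<cdot> a)"
    "(c *s a) \<cdot> b = c *s (a \<cdot> b)" "b \<cdot> (c *s a) = c *s (b \<cdot> a)"
    "0 \<cdot> b = 0" "b \<cdot> 0 = 0"
    by (simp_all add: l.add r.add l.diff r.diff l.neg r.neg l.scale r.scale l.zero r.zero)
qed

lemma odd_anticomm: "a \<in> gr 1 \<Longrightarrow> b \<in> gr 1 \<Longrightarrow> a \<cdot> b = - (b \<cdot> a)"
  using supercomm[of a 1 b 1] by (simp add: koszul_def)

lemma even_odd_comm: "x \<in> gr 0 \<Longrightarrow> a \<in> gr 1 \<Longrightarrow> a \<cdot> x = x \<cdot> a"
  using supercomm[of a 1 x 0] by (simp add: koszul_def)

lemma even_comm: "x \<in> gr 0 \<Longrightarrow> x' \<in> gr 0 \<Longrightarrow> x \<cdot> x' = x' \<cdot> x"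
  using supercomm[of x 0 x' 0] by (simp add: koszul_def)

lemma LA3': "a \<in> gr 1 \<Longrightarrow> b \<in> gr 1 \<Longrightarrow> c \<in> gr 1 \<Longrightarrow> b \<cdot> (a \<cdot> c) - a \<cdot> (b \<cdot> c) = c \<cdot> (a \<cdot> b)"
  using LA3[of a b c] odd_anticomm[of c a] by (simp add: mul_simps algebra_simps)

lemma LA1': "x \<in> gr 0 \<Longrightarrow> z \<in> gr 0 \<Longrightarrow> b \<in> gr 1 \<Longrightarrow> b \<cdot> (x \<cdot> z) = 2 *s (x \<cdot> (z \<cdot> b))"
  using LA1[of x z b] real_or_complex_two_neq_0[where ?'k = 'k]
  by (simp add: even_odd_comm[of "x \<cdot> z" b] mul_closed)

lemma act_invariant:
  assumes a: "a \<in> gr 1" and b: "b \<in> gr 1" and c: "c \<in> gr 1" and x: "x \<in> gr 0"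
  shows "(a \<cdot> x) \<cdot> (b \<cdot> c) + b \<cdot> ((a \<cdot> x) \<cdot> c) = a \<cdot> ((b \<cdot> x) \<cdot> c) + (b \<cdot> x) \<cdot> (a \<cdot> c)"
proof -
  note cl = mul_closed
  have half: "y + y = 2 *s y" for y
    using scale_left_distrib[of 1 1 y] by simp
  have e1: "(p \<cdot> x) \<cdot> (q \<cdot> c) = x \<cdot> ((q \<cdot> c) \<cdot> p)" if "p \<in> gr 1" "q \<in> gr 1" for p q
  proof -
    have "(p \<cdot> x) \<cdot> (q \<cdot> c) = (q \<cdot> c) \<cdot> (x \<cdot> p)"
      using that x c even_odd_comm[of "q \<cdot> c" "p \<cdot> x"] even_odd_comm[of x p] by (simp add: cl)
    also have "\<dots> = (1/2) *s (((q \<cdot> c) \<cdot> x) \<cdot> p)"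
      using that x c by (intro LA1) (simp_all add: cl)
    also have "\<dots> = (1/2) *s ((x \<cdot> (q \<cdot> c)) \<cdot> p)"
      using that x c by (simp add: even_comm[of "q \<cdot> c" x] cl)
    also have "\<dots> = x \<cdot> ((q \<cdot> c) \<cdot> p)"
      using that x c by (intro LA1[symmetric]) (simp_all add: cl)
    finally show ?thesis .
  qed
  have e2: "p \<cdot> ((q \<cdot> x) \<cdot> c) = 2 *s (x \<cdot> ((q \<cdot> c) \<cdot> p)) - p \<cdot> (q \<cdot> (x \<cdot> c))"
    if "p \<in> gr 1" "q \<in> gr 1" for p q
  proof -
    have "(q \<cdot> x) \<cdot> c = x \<cdot> (q \<cdot> c) - q \<cdot> (x \<cdot> c)"
      using LA2[of x q c] that x c even_odd_comm[of x q] by simp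
    then have "p \<cdot> ((q \<cdot> x) \<cdot> c) = p \<cdot> (x \<cdot> (q \<cdot> c)) - p \<cdot> (q \<cdot> (x \<cdot> c))"
      by (simp add: mul_simps)
    with LA1'[of x "q \<cdot> c" p] that x c show ?thesis
      by (simp add: cl)
  qed
  have e3: "b \<cdot> (a \<cdot> (x \<cdot> c)) - a \<cdot> (b \<cdot> (x \<cdot> c)) = x \<cdot> ((a \<cdot> c) \<cdot> b) - x \<cdot> ((b \<cdot> c) \<cdot> a)"
  proof -
    have "b \<cdot> (a \<cdot> (x \<cdot> c)) - a \<cdot> (b \<cdot> (x \<cdot> c)) = (x \<cdot> c) \<cdot> (a \<cdot> b)"
      using a b c x by (intro LA3') (simp_all add: cl)
    also have "\<dots> = (a \<cdot> b) \<cdot> (x \<cdot> c)"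
      using a b c x by (intro even_odd_comm) (simp_all add: cl)
    also have "\<dots> = (1/2) *s ((x \<cdot> (a \<cdot> b)) \<cdot> c)"
      using LA1[of "a \<cdot> b" x c] a b c x by (simp add: even_comm[of "a \<cdot> b" x] cl)
    also have "\<dots> = x \<cdot> ((a \<cdot> b) \<cdot> c)"
      using a b c x by (intro LA1[symmetric]) (simp_all add: cl)
    also have "(a \<cdot> b) \<cdot> c = b \<cdot> (a \<cdot> c) - a \<cdot> (b \<cdot> c)"
      using LA3'[of a b c] even_odd_comm[of "a \<cdot> b" c] a b c by (simp add: cl)
    also have "\<dots> = (a \<cdot> c) \<cdot> b - (b \<cdot> c) \<cdot> a"
      using a b c even_odd_comm[of "a \<cdot> c" b] even_odd_comm[of "b \<cdot> c" a] by (simp add: cl)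
    finally show ?thesis by (simp add: mul_simps)
  qed
  have fin: "P + (2 *s Q - R) = (2 *s P - T) + Q" if "R - T = Q - P" for P Q R T
  proof -
    from that have "R = Q - P + T"
      by (metis diff_add_cancel)
    then show ?thesis
      unfolding half[symmetric] by simp
  qed
  show ?thesis
    unfolding e1[OF a b] e1[OF b a] e2[OF b a] e2[OF a b] using e3 by (rule fin)
qed

lemma linear_act: "Vector_Spaces.linear fscale scale (\<lambda>u. act u c)"
  unfolding act_def by (intro fext_linear vector_space_axioms)

lemma act_symb: "act (symb a b) c = a \<cdot> (b \<cdot> c) + b \<cdot> (a \<cdot> c)"
  unfolding act_def by (simp add: fext_symb vector_space_axioms)

lemma linear_bracket1: "Vector_Spaces.linear fscale fscale (\<lambda>u. free_bracket u v)"
  unfolding free_bracket_def by (intro fext_linear free.vector_space_axioms)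

lemma free_bracket_symb:
  "free_bracket (symb a b) (symb c d) =
    fscale 2 (symb (a \<cdot> (b \<cdot> c)) d) + fscale 2 (symb (b \<cdot> (a \<cdot> d)) c)"
  unfolding free_bracket_def by (simp add: fext_symb free.vector_space_axioms)

lemma linear_bracket2: "Vector_Spaces.linear fscale fscale (\<lambda>v. free_bracket u v)"
proof -
  have "free_bracket u (v + w) = free_bracket u v + free_bracket u w" for v w
    unfolding free_bracket_def fext_def[of _ _ u]
    by (simp add: fext_add free.vector_space_axioms split_def sum.distrib free.scale_right_distrib)
  moreover have "free_bracket u (fscale c v) = fscale c (free_bracket u v)" for c v
    unfolding free_bracket_def fext_def[of _ _ u]
    by (simp add: fext_scale free.vector_space_axioms split_def free.scale_sum_right mult.commute)
  ultimately show ?thesis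
    by (simp add: linear_fscaleI free.vector_space_axioms)
qed

lemma symb_free_odd: "a \<in> gr 1 \<Longrightarrow> b \<in> gr 1 \<Longrightarrow> symb a b \<in> free_odd"
  by (simp add: free_odd_def symb_def)

lemma subspace_free_odd: "free.subspace free_odd"
proof (rule free.subspaceI)
  show "0 \<in> free_odd"
    by (simp add: free_odd_def)
  show "u + v \<in> free_odd" if "u \<in> free_odd" "v \<in> free_odd" for u v
    using that keys_add[of u v] by (auto simp: free_odd_def)
  have "Poly_Mapping.keys (fscale c u) \<subseteq> Poly_Mapping.keys u" for c :: 'k and u :: "('a \<times> 'a) \<Rightarrow>\<^sub>0 'k"
    by (auto simp: in_keys_iff)
  then show "fscale c u \<in> free_odd" if "u \<in> free_odd" for c u
    using that by (fastforce simp: free_odd_def)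
qed

lemma free_odd_induct [consumes 1, case_names zero add scale symb]:
  assumes u: "u \<in> free_odd"
    and "P 0"
    and "\<And>u v. P u \<Longrightarrow> P v \<Longrightarrow> P (u + v)"
    and "\<And>c u. P u \<Longrightarrow> P (fscale c u)"
    and "\<And>a b. a \<in> gr 1 \<Longrightarrow> b \<in> gr 1 \<Longrightarrow> P (symb a b)"
  shows "P u"
proof -
  have expand: "u = (\<Sum>p \<in> Poly_Mapping.keys u. fscale (Poly_Mapping.lookup u p) (symb (fst p) (snd p)))"
  proof (rule poly_mapping_eqI)
    fix q
    have "(\<Sum>p \<in> Poly_Mapping.keys u. Poly_Mapping.lookup u p * (1 when p = q)) =
        (\<Sum>p \<in> Poly_Mapping.keys u. if q = p then Poly_Mapping.lookup u q else 0)"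
      by (intro sum.cong) (auto simp: when_def)
    then show "Poly_Mapping.lookup u q = Poly_Mapping.lookup
      (\<Sum>p \<in> Poly_Mapping.keys u. fscale (Poly_Mapping.lookup u p) (symb (fst p) (snd p))) q"
      by (simp add: lookup_sum symb_def lookup_single in_keys_iff)
  qed
  have "P (\<Sum>p \<in> K. fscale (Poly_Mapping.lookup u p) (symb (fst p) (snd p)))"
    if "finite K" "K \<subseteq> Poly_Mapping.keys u" for K
    using that
  proof (induction K rule: finite_induct)
    case empty
    then show ?case using assms(2) by simp
  next
    case (insert p K)
    then have "fst p \<in> gr 1" "snd p \<in> gr 1"
      using u by (auto simp: free_odd_def)
    with insert show ?case
      using assms(3-5) by simp
  qed
  from this[of "Poly_Mapping.keys u"] show ?thesis
    using expand by simp
qed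

lemma adj_null_subset: "adj_null \<subseteq> free_odd"
  unfolding adj_null_def
proof (rule free.span_minimal[OF _ subspace_free_odd])
  show "tensor_rels \<union> S_rels \<subseteq> free_odd"
    unfolding tensor_rels_def S_rels_def
    by (intro subsetI, elim UnE CollectE exE conjE; hypsubst)
      (simp_all add: free.subspace_diff[OF subspace_free_odd] free.subspace_scale[OF subspace_free_odd]
        symb_free_odd odd_closed mul_closed)
qed

lemma subspace_adj_null: "free.subspace adj_null"
  unfolding adj_null_def by (rule free.subspace_span)

definition eqv :: "(('a \<times> 'a) \<Rightarrow>\<^sub>0 'k) \<Rightarrow> (('a \<times> 'a) \<Rightarrow>\<^sub>0 'k) \<Rightarrow> bool" (infix \<open>\<approx>\<close> 50) where
  "u \<approx> v \<longleftrightarrow> u - v \<in> adj_null"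

lemma eqv_refl [simp]: "u \<approx> u"
  by (simp add: eqv_def free.subspace_0[OF subspace_adj_null])

lemma eqv_sym: "u \<approx> v \<Longrightarrow> v \<approx> u"
  unfolding eqv_def using free.subspace_neg[OF subspace_adj_null, of "u - v"] by simp

lemma eqv_trans [trans]: "u \<approx> v \<Longrightarrow> v \<approx> w \<Longrightarrow> u \<approx> w"
  unfolding eqv_def using free.subspace_add[OF subspace_adj_null, of "u - v" "v - w"] by simp

lemma eqv_add: "u \<approx> v \<Longrightarrow> u' \<approx> v' \<Longrightarrow> u + u' \<approx> v + v'"
  unfolding eqv_def using free.subspace_add[OF subspace_adj_null, of "u - v" "u' - v'"]
  by (simp add: algebra_simps)

lemma eqv_diff: "u \<approx> v \<Longrightarrow> u' \<approx> v' \<Longrightarrow> u - u' \<approx> v - v'"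
  unfolding eqv_def using free.subspace_diff[OF subspace_adj_null, of "u - v" "u' - v'"]
  by (simp add: algebra_simps)

lemma eqv_scale: "u \<approx> v \<Longrightarrow> fscale c u \<approx> fscale c v"
  unfolding eqv_def using free.subspace_scale[OF subspace_adj_null, of "u - v" c]
  by (simp add: free.scale_right_diff_distrib)

lemma rel_null: "r \<in> tensor_rels \<union> S_rels \<Longrightarrow> r \<in> adj_null"
  unfolding adj_null_def by (rule free.span_base)

lemma symb_eqv:
  assumes "a \<in> gr 1" "b \<in> gr 1"
  shows symb_add1: "a' \<in> gr 1 \<Longrightarrow> symb (a + a') b \<approx> symb a b + symb a' b"
    and symb_add2: "b' \<in> gr 1 \<Longrightarrow> symb a (b + b') \<approx> symb a b + symb a b'"
    and symb_scale1: "symb (c *s a) b \<approx> fscale c (symb a b)"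
    and symb_scale2: "symb a (c *s b) \<approx> fscale c (symb a b)"
    and symb_comm: "symb a b \<approx> symb b a"
    and symb_inv: "x \<in> gr 0 \<Longrightarrow> symb (a \<cdot> x) b \<approx> symb a (b \<cdot> x)"
  unfolding eqv_def diff_diff_eq[symmetric] using assms
  by - (rule rel_null, unfold tensor_rels_def S_rels_def, blast)+

lemma symb_neg2: "a \<in> gr 1 \<Longrightarrow> b \<in> gr 1 \<Longrightarrow> symb a (- b) \<approx> - symb a b"
  using symb_scale2[of a b "- 1"] by simp

lemma symb_diff2:
  "a \<in> gr 1 \<Longrightarrow> b \<in> gr 1 \<Longrightarrow> b' \<in> gr 1 \<Longrightarrow> symb a b - symb a b' \<approx> symb a (b - b')"
  using symb_add2[of a "b - b'" b'] by (simp add: odd_closed eqv_def algebra_simps)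

lemma act_closed: "u \<in> free_odd \<Longrightarrow> c \<in> gr 1 \<Longrightarrow> act u c \<in> gr 1"
proof (induction u rule: free_odd_induct)
  interpret l: Vector_Spaces.linear fscale scale "\<lambda>u. act u c" by (rule linear_act)
  case zero then show ?case by (simp add: l.zero odd_closed)
next
  interpret l: Vector_Spaces.linear fscale scale "\<lambda>u. act u c" by (rule linear_act)
  case (add u v) then show ?case by (simp add: l.add odd_closed)
next
  interpret l: Vector_Spaces.linear fscale scale "\<lambda>u. act u c" by (rule linear_act)
  case (scale k u) then show ?case by (simp add: l.scale odd_closed)
next
  case (symb a b) then show ?case by (simp add: act_symb odd_closed mul_closed)
qed

lemma act_null:
  assumes "u \<in> adj_null" "c \<in> gr 1"
  shows "act u c = 0"
proof -
  interpret l: Vector_Spaces.linear fscale scale "\<lambda>u. act u c" by (rule linear_act)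
  note simps = l.diff l.scale act_symb mul_simps scale_right_distrib
  have tens: "act r c = 0" if "r \<in> tensor_rels" for r
    using that unfolding tensor_rels_def by (auto simp: simps)
  have inv: "act (symb (a \<cdot> x) b - symb a (b \<cdot> x)) c = 0"
    if "a \<in> gr 1" "b \<in> gr 1" "x \<in> gr 0" for a b x
    using act_invariant[of a b c x] that assms(2) by (simp add: l.diff act_symb)
  have comm: "act (symb a b - symb b a) c = 0" for a b
    by (simp add: l.diff act_symb add.commute)
  have "act r c = 0" if "r \<in> S_rels" for r
    using that inv comm unfolding S_rels_def by blast
  with tens have "act r c = 0" if "r \<in> tensor_rels \<union> S_rels" for r
    using that by blast
  then show ?thesis
    using l.eq_0_on_span[of "tensor_rels \<union> S_rels" u] assms(1) by (simp add: adj_null_def)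
qed

lemma bracket_symb_eqv:
  assumes a: "a \<in> gr 1" and b: "b \<in> gr 1" and c: "c \<in> gr 1" and d: "d \<in> gr 1"
  shows "free_bracket (symb a b) (symb c d) \<approx> symb (act (symb a b) c) d + symb c (act (symb a b) d)"
proof -
  note cl = mul_closed odd_closed
  have k: "symb (p \<cdot> (q \<cdot> c)) d - symb (p \<cdot> (q \<cdot> d)) c \<approx> - symb p (q \<cdot> (c \<cdot> d))"
    if p: "p \<in> gr 1" and q: "q \<in> gr 1" for p q
  proof -
    have "symb (p \<cdot> (q \<cdot> c)) d - symb (p \<cdot> (q \<cdot> d)) c \<approx> symb p (d \<cdot> (q \<cdot> c)) - symb p (c \<cdot> (q \<cdot> d))"
      using p q c d by (intro eqv_diff symb_inv) (simp_all add: cl)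
    also have "\<dots> \<approx> symb p (d \<cdot> (q \<cdot> c) - c \<cdot> (q \<cdot> d))"
      using p q c d by (intro symb_diff2) (simp_all add: cl)
    also have "d \<cdot> (q \<cdot> c) - c \<cdot> (q \<cdot> d) = - (q \<cdot> (c \<cdot> d))"
      using LA3[of q c d] odd_anticomm[of d q] q c d by (simp add: mul_simps algebra_simps)
    also have "symb p (- (q \<cdot> (c \<cdot> d))) \<approx> - symb p (q \<cdot> (c \<cdot> d))"
      using p q c d by (intro symb_neg2) (simp_all add: cl)
    finally show ?thesis .
  qed
  have swap: "symb a (b \<cdot> (c \<cdot> d)) \<approx> symb b (a \<cdot> (c \<cdot> d))"
  proof -
    have "symb a (b \<cdot> (c \<cdot> d)) \<approx> symb (a \<cdot> (c \<cdot> d)) b"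
      using a b c d by (intro eqv_sym[OF symb_inv]) (simp_all add: cl)
    also have "\<dots> \<approx> symb b (a \<cdot> (c \<cdot> d))"
      using a b c d by (intro symb_comm) (simp_all add: cl)
    finally show ?thesis .
  qed
  let ?ac = "symb (a \<cdot> (b \<cdot> c)) d" and ?ad = "symb (a \<cdot> (b \<cdot> d)) c"
  let ?bc = "symb (b \<cdot> (a \<cdot> c)) d" and ?bd = "symb (b \<cdot> (a \<cdot> d)) c"
  have "?ac - ?ad \<approx> - symb b (a \<cdot> (c \<cdot> d))"
    using eqv_trans[OF k[OF a b]] eqv_diff[OF eqv_refl[of 0] swap] by simp
  then have "?ac - ?ad \<approx> ?bc - ?bd"
    using eqv_sym[OF k[OF b a]] by (rule eqv_trans)
  then have main: "?ac + ?bd \<approx> ?bc + ?ad"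
    by (simp add: eqv_def algebra_simps)
  have "free_bracket (symb a b) (symb c d) = (?ac + ?bd) + (?ac + ?bd)"
    by (simp add: free_bracket_symb fscale_two)
  also have "\<dots> \<approx> (?ac + ?bd) + (?bc + ?ad)"
    by (intro eqv_add main eqv_refl)
  also have "\<dots> = (?ac + ?bc) + (?ad + ?bd)"
    by (simp add: algebra_simps)
  also have "\<dots> \<approx> symb (act (symb a b) c) d + symb c (act (symb a b) d)"
  proof (rule eqv_add)
    show "?ac + ?bc \<approx> symb (act (symb a b) c) d"
      unfolding act_symb using a b c d by (intro eqv_sym[OF symb_add1]) (simp_all add: cl)
    have "?ad + ?bd \<approx> symb (act (symb a b) d) c"
      unfolding act_symb using a b c d by (intro eqv_sym[OF symb_add1]) (simp_all add: cl)
    also have "\<dots> \<approx> symb c (act (symb a b) d)"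
      unfolding act_symb using a b c d by (intro symb_comm) (simp_all add: cl)
    finally show "?ad + ?bd \<approx> symb c (act (symb a b) d)" .
  qed
  finally show ?thesis .
qed

lemma bracket_free_eqv:
  assumes "u \<in> free_odd" and c: "c \<in> gr 1" and d: "d \<in> gr 1"
  shows "free_bracket u (symb c d) \<approx> symb (act u c) d + symb c (act u d)"
proof -
  interpret l: Vector_Spaces.linear fscale fscale "\<lambda>u. free_bracket u (symb c d)"
    by (rule linear_bracket1)
  interpret lc: Vector_Spaces.linear fscale scale "\<lambda>u. act u c" by (rule linear_act)
  interpret ld: Vector_Spaces.linear fscale scale "\<lambda>u. act u d" by (rule linear_act)
  have "u \<in> free_odd \<and> free_bracket u (symb c d) \<approx> symb (act u c) d + symb c (act u d)"
    using assms(1)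
  proof (induction u rule: free_odd_induct)
    case zero
    have "symb (0 *s 0) d + symb c (0 *s 0) \<approx> fscale 0 (symb 0 d) + fscale 0 (symb c 0)"
      using c d by (intro eqv_add symb_scale1 symb_scale2) (simp_all add: odd_closed)
    then show ?case
      by (simp add: l.zero lc.zero ld.zero eqv_sym free.subspace_0[OF subspace_free_odd])
  next
    case (add u v)
    have "free_bracket (u + v) (symb c d) \<approx>
        (symb (act u c) d + symb c (act u d)) + (symb (act v c) d + symb c (act v d))"
      unfolding l.add using add by (intro eqv_add) simp_all
    also have "\<dots> = (symb (act u c) d + symb (act v c) d) + (symb c (act u d) + symb c (act v d))"
      by (simp add: algebra_simps)
    also have "\<dots> \<approx> symb (act (u + v) c) d + symb c (act (u + v) d)"
      unfolding lc.add ld.add using add c d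
      by (intro eqv_add eqv_sym[OF symb_add1] eqv_sym[OF symb_add2]) (simp_all add: act_closed)
    finally show ?case
      using add free.subspace_add[OF subspace_free_odd] by blast
  next
    case (scale k u)
    have "free_bracket (fscale k u) (symb c d) \<approx> fscale k (symb (act u c) d + symb c (act u d))"
      unfolding l.scale using scale by (intro eqv_scale) simp_all
    also have "\<dots> \<approx> symb (act (fscale k u) c) d + symb c (act (fscale k u) d)"
      unfolding lc.scale ld.scale free.scale_right_distrib using scale c d
      by (intro eqv_add eqv_sym[OF symb_scale1] eqv_sym[OF symb_scale2]) (simp_all add: act_closed)
    finally show ?case
      using scale free.subspace_scale[OF subspace_free_odd] by blast
  next
    case (symb a b)
    then show ?case
      using c d by (simp add: bracket_symb_eqv symb_free_odd)
  qed
  then show ?thesis by simp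
qed

lemma bracket_null1:
  assumes u: "u \<in> adj_null" and v: "v \<in> free_odd"
  shows "free_bracket u v \<in> adj_null"
  using v
proof (induction v rule: free_odd_induct)
  interpret l: Vector_Spaces.linear fscale fscale "free_bracket u" by (rule linear_bracket2)
  case zero then show ?case by (simp add: l.zero free.subspace_0[OF subspace_adj_null])
next
  interpret l: Vector_Spaces.linear fscale fscale "free_bracket u" by (rule linear_bracket2)
  case (add v w) then show ?case by (simp add: l.add free.subspace_add[OF subspace_adj_null])
next
  interpret l: Vector_Spaces.linear fscale fscale "free_bracket u" by (rule linear_bracket2)
  case (scale k v) then show ?case by (simp add: l.scale free.subspace_scale[OF subspace_adj_null])
next
  case (symb c d)
  have "free_bracket u (symb c d) \<approx> symb (act u c) d + symb c (act u d)"
    using u adj_null_subset symb by (intro bracket_free_eqv) auto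
  also have "\<dots> = symb (0 *s 0) d + symb c (0 *s 0)"
    using u symb by (simp add: act_null)
  also have "\<dots> \<approx> fscale 0 (symb 0 d) + fscale 0 (symb c 0)"
    using symb by (intro eqv_add symb_scale1 symb_scale2) (simp_all add: odd_closed)
  finally show ?case by (simp add: eqv_def)
qed

lemma bracket_antisym:
  assumes "u \<in> free_odd" "v \<in> free_odd"
  shows "free_bracket u v + free_bracket v u \<in> adj_null"
  using assms(1)
proof (induction u rule: free_odd_induct)
  interpret l: Vector_Spaces.linear fscale fscale "free_bracket v" by (rule linear_bracket2)
  interpret m: Vector_Spaces.linear fscale fscale "\<lambda>u. free_bracket u v" by (rule linear_bracket1)
  note sub = free.subspace_0[OF subspace_adj_null] free.subspace_add[OF subspace_adj_null]
    free.subspace_scale[OF subspace_adj_null]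
  {
    case zero then show ?case by (simp add: l.zero m.zero sub)
  next
    case (add u w)
    from sub(2)[OF add] show ?case by (simp add: l.add m.add algebra_simps)
  next
    case (scale k u)
    from sub(3)[OF scale] show ?case by (simp add: l.scale m.scale free.scale_right_distrib)
  next
    case (symb a b)
    from assms(2) show ?case
    proof (induction v rule: free_odd_induct)
      interpret l: Vector_Spaces.linear fscale fscale "free_bracket (symb a b)"
        by (rule linear_bracket2)
      interpret m: Vector_Spaces.linear fscale fscale "\<lambda>u. free_bracket u (symb a b)"
        by (rule linear_bracket1)
      {
        case zero then show ?case by (simp add: l.zero m.zero sub)
      next
        case (add u w)
        from sub(2)[OF add] show ?case by (simp add: l.add m.add algebra_simps)
      next
        case (scale k u)
        from sub(3)[OF scale] show ?case by (simp add: l.scale m.scale free.scale_right_distrib)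
      next
        case (symb c d)
        note g = \<open>a \<in> gr 1\<close> \<open>b \<in> gr 1\<close> \<open>c \<in> gr 1\<close> \<open>d \<in> gr 1\<close>
        note cl = mul_closed odd_closed
        have k: "symb (p \<cdot> (q \<cdot> r)) s + symb (s \<cdot> (r \<cdot> q)) p \<in> adj_null"
          if h: "p \<in> gr 1" "q \<in> gr 1" "r \<in> gr 1" "s \<in> gr 1" for p q r s
        proof -
          have neg: "s \<cdot> (r \<cdot> q) = - (s \<cdot> (q \<cdot> r))"
            using h odd_anticomm[of r q] by (simp add: mul_simps)
          have "symb (s \<cdot> (r \<cdot> q)) p \<approx> symb p (s \<cdot> (r \<cdot> q))"
            using h by (intro symb_comm) (simp_all add: cl)
          also have "\<dots> \<approx> - symb p (s \<cdot> (q \<cdot> r))"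
            unfolding neg using h by (intro symb_neg2) (simp_all add: cl)
          finally have "symb (p \<cdot> (q \<cdot> r)) s + symb (s \<cdot> (r \<cdot> q)) p \<approx>
              symb p (s \<cdot> (q \<cdot> r)) + - symb p (s \<cdot> (q \<cdot> r))"
            using h by (intro eqv_add symb_inv) (simp_all add: cl)
          then show ?thesis by (simp add: eqv_def)
        qed
        have "free_bracket (symb a b) (symb c d) + free_bracket (symb c d) (symb a b) =
            fscale 2 ((symb (a \<cdot> (b \<cdot> c)) d + symb (d \<cdot> (c \<cdot> b)) a) +
              (symb (b \<cdot> (a \<cdot> d)) c + symb (c \<cdot> (d \<cdot> a)) b))"
          by (simp add: free_bracket_symb free.scale_right_distrib algebra_simps)
        then show ?case
          using k[of a b c d] k[of b a d c] g by (simp add: sub del: free.scale_right_distrib)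
      }
    qed
  }
qed

lemma bracket_null2:
  assumes "u \<in> free_odd" "v \<in> adj_null"
  shows "free_bracket u v \<in> adj_null"
  using bracket_antisym[of u v] bracket_null1[of v u] assms adj_null_subset
    free.subspace_diff[OF subspace_adj_null, of "free_bracket u v + free_bracket v u" "free_bracket v u"]
  by auto

lemma free_bracket_closed:
  assumes "u \<in> free_odd" "v \<in> free_odd"
  shows "free_bracket u v \<in> free_odd"
proof -
  have "fst p \<in> gr 1" "snd p \<in> gr 1"
    if "p \<in> Poly_Mapping.keys u \<or> p \<in> Poly_Mapping.keys v" for p
    using assms that by (auto simp: free_odd_def)
  then show ?thesis
    unfolding free_bracket_def fext_def split_def
    by (intro free.subspace_sum[OF subspace_free_odd] free.subspace_scale[OF subspace_free_odd]
        free.subspace_add[OF subspace_free_odd] symb_free_odd) (simp_all add: mul_closed)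
qed

lemma equiv_adj_rel: "equiv free_odd adj_rel"
proof (rule equivI)
  show "adj_rel \<subseteq> free_odd \<times> free_odd"
    by (auto simp: adj_rel_def)
  show "refl_on free_odd adj_rel"
    by (auto simp: refl_on_def adj_rel_def free.subspace_0[OF subspace_adj_null])
  show "Relation.sym adj_rel"
  proof (rule symI)
    show "(v, u) \<in> adj_rel" if "(u, v) \<in> adj_rel" for u v
      using that eqv_sym[of u v] by (simp add: adj_rel_def eqv_def)
  qed
  show "trans adj_rel"
  proof (rule transI)
    show "(u, w) \<in> adj_rel" if "(u, v) \<in> adj_rel" "(v, w) \<in> adj_rel" for u v w
      using that eqv_trans[of u v w] by (simp add: adj_rel_def eqv_def)
  qed
qed

lemma mem_cls: "w \<in> cls u \<longleftrightarrow> u \<in> free_odd \<and> w \<in> free_odd \<and> u - w \<in> adj_null"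
  by (auto simp: cls_def adj_rel_def)

lemma cls_self: "u \<in> free_odd \<Longrightarrow> u \<in> cls u"
  by (simp add: mem_cls free.subspace_0[OF subspace_adj_null])

lemma cls_eq_iff:
  assumes "u \<in> free_odd" "v \<in> free_odd"
  shows "cls u = cls v \<longleftrightarrow> u - v \<in> adj_null"
proof -
  have "cls u = cls v \<longleftrightarrow> (u, v) \<in> adj_rel"
    unfolding cls_def by (rule eq_equiv_class_iff[OF equiv_adj_rel]) fact+
  then show ?thesis
    using assms by (simp add: adj_rel_def)
qed

lemma free_odd_closed:
  shows "0 \<in> free_odd" and "u \<in> free_odd \<Longrightarrow> v \<in> free_odd \<Longrightarrow> u + v \<in> free_odd"
    and "u \<in> free_odd \<Longrightarrow> fscale c u \<in> free_odd"
proof -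
  show "0 \<in> free_odd" by (rule free.subspace_0[OF subspace_free_odd])
  show "u + v \<in> free_odd" if "u \<in> free_odd" "v \<in> free_odd"
    using that by (rule free.subspace_add[OF subspace_free_odd])
  show "fscale c u \<in> free_odd" if "u \<in> free_odd"
    using that by (rule free.subspace_scale[OF subspace_free_odd])
qed

lemma adj_even_iff: "X \<in> adj_even \<longleftrightarrow> (\<exists>u \<in> free_odd. X = cls u)"
proof
  assume "X \<in> adj_even"
  then show "\<exists>u \<in> free_odd. X = cls u"
    unfolding adj_even_def cls_def by (rule quotientE) (rule bexI)
next
  assume "\<exists>u \<in> free_odd. X = cls u"
  then obtain u where "u \<in> free_odd" "X = cls u" ..
  then show "X \<in> adj_even"
    unfolding adj_even_def cls_def by (simp add: quotientI)
qed

lemma adj_even_add_cls: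
  assumes "u \<in> free_odd" "v \<in> free_odd"
  shows "adj_even_add (cls u) (cls v) = cls (u + v)"
proof -
  have "cls (u + v) = cls (u' + v')" if "u' \<in> cls u" "v' \<in> cls v" for u' v'
    using eqv_add[of u u' v v'] that by (simp add: cls_eq_iff mem_cls eqv_def free_odd_closed)
  then show ?thesis
    unfolding adj_even_add_def using cls_self assms by blast
qed

lemma adj_even_scale_cls:
  assumes "u \<in> free_odd"
  shows "adj_even_scale c (cls u) = cls (fscale c u)"
proof -
  have "cls (fscale c u) = cls (fscale c u')" if "u' \<in> cls u" for u'
    using eqv_scale[of u u' c] that by (simp add: cls_eq_iff mem_cls eqv_def free_odd_closed)
  then show ?thesis
    unfolding adj_even_scale_def using cls_self assms by blast
qed

lemma even_even_cls:
  assumes "u \<in> free_odd" "v \<in> free_odd"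
  shows "even_even (cls u) (cls v) = cls (free_bracket u v)"
proof -
  have "cls (free_bracket u v) = cls (free_bracket u' v')" if "u' \<in> cls u" "v' \<in> cls v" for u' v'
  proof -
    interpret l: Vector_Spaces.linear fscale fscale "free_bracket u" by (rule linear_bracket2)
    interpret m: Vector_Spaces.linear fscale fscale "\<lambda>u. free_bracket u v'" by (rule linear_bracket1)
    have "free_bracket u v - free_bracket u' v' = free_bracket u (v - v') + free_bracket (u - u') v'"
      by (simp add: l.diff m.diff)
    also have "\<dots> \<in> adj_null"
      using that
      by (intro free.subspace_add[OF subspace_adj_null] bracket_null1 bracket_null2)
        (auto simp: mem_cls)
    finally show ?thesis
      using that by (simp add: cls_eq_iff mem_cls free_bracket_closed)
  qed
  then show ?thesis
    unfolding even_even_def using cls_self assms by blast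
qed

lemma even_odd_cls:
  assumes "u \<in> free_odd" "c \<in> gr 1"
  shows "even_odd (cls u) c = act u c"
proof -
  interpret l: Vector_Spaces.linear fscale scale "\<lambda>u. act u c" by (rule linear_act)
  have "act w c = act u c" if "w \<in> cls u" for w
    using act_null[of "u - w" c] that assms(2) by (simp add: mem_cls l.diff)
  then have "(\<lambda>w. act w c) ` cls u = {act u c}"
    using cls_self[OF assms(1)] by blast
  then show ?thesis
    by (simp add: even_odd_def)
qed

text \<open>The quotient constructions are independent of representatives, and the bracket is given on
  generators by the expected formulas.\<close>

lemma adjoint_bracket:
  assumes g: "a \<in> gr 1" "b \<in> gr 1" "c \<in> gr 1" "d \<in> gr 1"
  shows "lbracket adjoint (odd_elem a) (odd_elem b) = odot a b"
    and "lbracket adjoint (odot a b) (odd_elem c) = odd_elem (a \<cdot> (b \<cdot> c) + b \<cdot> (a \<cdot> c))"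
    and "lbracket adjoint (odd_elem c) (odot a b) = odd_elem (- (a \<cdot> (b \<cdot> c) + b \<cdot> (a \<cdot> c)))"
    and "lbracket adjoint (odot a b) (odot c d) =
      ladd adjoint (lscale adjoint 2 (odot (a \<cdot> (b \<cdot> c)) d)) (lscale adjoint 2 (odot (b \<cdot> (a \<cdot> d)) c))"
proof -
  have z: "cls (symb p 0) = cls 0" "cls (symb 0 p) = cls 0" if "p \<in> gr 1" for p
    using symb_scale2[of p 0 0] symb_scale1[of 0 p 0] that
    by (simp_all add: cls_eq_iff symb_free_odd odd_closed free_odd_closed eqv_def)
  have a0: "act 0 y = 0" for y
    unfolding act_def fext_def by simp
  have b0: "free_bracket 0 v = 0" "free_bracket v 0 = 0" for v
    unfolding free_bracket_def fext_def by (simp_all add: split_def)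
  have act: "act u 0 = 0" for u
    unfolding act_def fext_def by (simp add: mul_simps split_def)
  note s = adjoint_def odd_elem_def odot_def even_even_cls even_odd_cls adj_even_add_cls
    adj_even_scale_cls symb_free_odd free_odd_closed mul_closed odd_closed g z a0 b0 act act_symb
    free_bracket_closed
  show "lbracket adjoint (odd_elem a) (odd_elem b) = odot a b"
    by (simp add: s)
  show "lbracket adjoint (odot a b) (odd_elem c) = odd_elem (a \<cdot> (b \<cdot> c) + b \<cdot> (a \<cdot> c))"
    by (simp add: s)
  show "lbracket adjoint (odd_elem c) (odot a b) = odd_elem (- (a \<cdot> (b \<cdot> c) + b \<cdot> (a \<cdot> c)))"
    by (simp add: s)
  show "lbracket adjoint (odot a b) (odot c d) =
      ladd adjoint (lscale adjoint 2 (odot (a \<cdot> (b \<cdot> c)) d)) (lscale adjoint 2 (odot (b \<cdot> (a \<cdot> d)) c))"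
    by (simp add: s free_bracket_symb)
qed

end

text \<open>\<open>\<phi>\<close> is the map of the theorem: linear with the prescribed values on the generators. Only its
  values on the carrier matter.\<close>

definition is_rho_tilde ::
  "('k::real_or_complex \<Rightarrow> 'a::ab_group_add \<Rightarrow> 'a) \<Rightarrow> ('a \<Rightarrow> 'a \<Rightarrow> 'a) \<Rightarrow> (bit \<Rightarrow> 'a set) \<Rightarrow>
    ('k \<Rightarrow> 'v::ab_group_add \<Rightarrow> 'v) \<Rightarrow> ('a \<Rightarrow> 'v \<Rightarrow> 'v) \<Rightarrow>
    ((('a \<times> 'a) \<Rightarrow>\<^sub>0 'k) set \<times> 'a \<Rightarrow> 'v \<Rightarrow> 'v) \<Rightarrow> bool" where
  "is_rho_tilde scaleA mul grA scaleV \<rho> \<phi> \<longleftrightarrow>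
    linear_to_End (lie_antialgebra.adjoint scaleA mul grA) scaleV \<phi> \<and>
    (\<forall>a \<in> grA 1. \<phi> (lie_antialgebra.odd_elem scaleA mul grA a) = \<rho> a) \<and>
    (\<forall>a \<in> grA 1. \<forall>b \<in> grA 1. \<forall>v.
      \<phi> (lie_antialgebra.odot scaleA mul grA a b) v = scaleV (1/2) (\<rho> a (\<rho> b v) + \<rho> b (\<rho> a v)))"

end

theory Submission
  imports Defs
begin

text \<open>Write \<open>A\<close>, \<open>B\<close>, \<open>C\<close> for the operators of odd elements \<open>a\<close>, \<open>b\<close>, \<open>c\<close> and \<open>X\<close> for that of an
  even \<open>x\<close>. The defect of the anticommutator on \<open>ax \<otimes> b - a \<otimes> bx\<close> is a multiple of the commutator
  of \<open>X\<close> with \<open>AB - BA\<close>. The latter represents the even element \<open>2ab\<close>, so it commutes with \<open>X\<close>,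
  and the extension to \<open>a \<odot> b\<close> is well defined. Expanding \<open>a(bc) + b(ac)\<close> shows that an even
  element \<open>u\<close> acts on odd ones through half of the commutator with its own operator. Commutators are
  derivations and \<open>[u, c \<odot> d] = [u, c] \<odot> d + c \<odot> [u, d]\<close> in the quotient, so the same holds for
  the bracket of even elements.\<close>

context LA_representation
begin

section \<open>Linearity of \<open>\<rho>\<close> and the operators of products\<close>

lemma rho_simps:
  "\<rho> a (v + w) = \<rho> a v + \<rho> a w" "\<rho> a (v - w) = \<rho> a v - \<rho> a w"
  "\<rho> a (scaleV c v) = scaleV c (\<rho> a v)" "\<rho> a 0 = 0"
  "\<rho> (a + b) v = \<rho> a v + \<rho> b v" "\<rho> (- a) v = - \<rho> a v"
  "\<rho> (scaleA c a) v = scaleV c (\<rho> a v)" "\<rho> 0 v = 0"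
proof -
  interpret e: Vector_Spaces.linear scaleV scaleV "\<rho> a" by (rule rho_End)
  interpret l: Vector_Spaces.linear scaleA scaleV "\<lambda>a. \<rho> a v" by (rule rho_linear)
  show "\<rho> a (v + w) = \<rho> a v + \<rho> a w" "\<rho> a (v - w) = \<rho> a v - \<rho> a w"
    "\<rho> a (scaleV c v) = scaleV c (\<rho> a v)" "\<rho> a 0 = 0"
    "\<rho> (a + b) v = \<rho> a v + \<rho> b v" "\<rho> (- a) v = - \<rho> a v"
    "\<rho> (scaleA c a) v = scaleV c (\<rho> a v)" "\<rho> 0 v = 0"
    by (simp_all add: e.add e.diff e.scale e.zero l.add l.neg l.scale l.zero)
qed

lemma rho_mul_odd_odd:
  "a \<in> grA 1 \<Longrightarrow> b \<in> grA 1 \<Longrightarrow> \<rho> (mul a b) v = scaleV (1/2) (\<rho> a (\<rho> b v) - \<rho> b (\<rho> a v))"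
  using rho_mul[of a 1 b 1 v] by (simp add: koszul_def)

lemma rho_mul_odd_even:
  "a \<in> grA 1 \<Longrightarrow> x \<in> grA 0 \<Longrightarrow> \<rho> (mul a x) v = scaleV (1/2) (\<rho> a (\<rho> x v) + \<rho> x (\<rho> a v))"
  using rho_mul[of a 1 x 0 v] by (simp add: koszul_def)

section \<open>Operators of even elements, first on the free space\<close>

definition half_anticomm :: "'a \<Rightarrow> 'a \<Rightarrow> 'v \<Rightarrow> 'v" where
  "half_anticomm a b v = scaleV (1/2) (\<rho> a (\<rho> b v) + \<rho> b (\<rho> a v))"

text \<open>Working on free representatives makes linearity in \<open>u\<close> automatic; descent
  to the quotient is left to \<open>even_rho_null\<close>.\<close>

definition even_rho :: "(('a \<times> 'a) \<Rightarrow>\<^sub>0 'k) \<Rightarrow> 'v \<Rightarrow> 'v" where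
  "even_rho u v = fext scaleV (\<lambda>(a, b). half_anticomm a b v) u"

text \<open>Since \<open>mul a b\<close> is even, \<open>rho_comm\<close> lets its operator, half of
  the commutator of \<open>\<rho> a\<close> and \<open>\<rho> b\<close>, pass through
  \<open>\<rho> x\<close>. This is the only use of \<open>rho_comm\<close>.\<close>

lemma half_anticomm_invariant:
  assumes a: "a \<in> grA 1" and b: "b \<in> grA 1" and x: "x \<in> grA 0"
  shows "half_anticomm (mul a x) b v = half_anticomm a (mul b x) v"
proof -
  have "\<rho> (mul a b) (\<rho> x v) = \<rho> x (\<rho> (mul a b) v)"
    using a b x by (intro rho_comm) (simp_all add: A.mul_closed)
  then have "scaleV (1/2) (\<rho> a (\<rho> b (\<rho> x v)) - \<rho> b (\<rho> a (\<rho> x v))) =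
      scaleV (1/2) (\<rho> x (\<rho> a (\<rho> b v)) - \<rho> x (\<rho> b (\<rho> a v)))"
    using a b by (simp add: rho_mul_odd_odd rho_simps)
  then have "\<rho> a (\<rho> b (\<rho> x v)) - \<rho> b (\<rho> a (\<rho> x v)) = \<rho> x (\<rho> a (\<rho> b v)) - \<rho> x (\<rho> b (\<rho> a v))"
    using real_or_complex_two_neq_0[where ?'k = 'k] by (simp only: V.scale_cancel_left) simp
  \<comment> \<open>Adding the terms with \<open>\<rho> x\<close> in the middle, common to both
    sides, produces four times each side of the goal.\<close>
  then have "\<rho> a (\<rho> x (\<rho> b v)) + \<rho> x (\<rho> a (\<rho> b v)) + (\<rho> b (\<rho> a (\<rho> x v)) + \<rho> b (\<rho> x (\<rho> a v))) =
      \<rho> a (\<rho> b (\<rho> x v)) + \<rho> a (\<rho> x (\<rho> b v)) + (\<rho> b (\<rho> x (\<rho> a v)) + \<rho> x (\<rho> b (\<rho> a v)))"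
    by (simp add: algebra_simps)
  then show ?thesis
    using a b x
    by (simp add: half_anticomm_def rho_mul_odd_even rho_simps V.scale_right_distrib[symmetric])
qed

lemma even_rho_linear: "Vector_Spaces.linear fscale scaleV (\<lambda>u. even_rho u v)"
  unfolding even_rho_def by (intro fext_linear V.vector_space_axioms)

lemma even_rho_simps:
  "even_rho (u + w) v = even_rho u v + even_rho w v" "even_rho (u - w) v = even_rho u v - even_rho w v"
  "even_rho (fscale c u) v = scaleV c (even_rho u v)" "even_rho 0 v = 0"
proof -
  interpret l: Vector_Spaces.linear fscale scaleV "\<lambda>u. even_rho u v" by (rule even_rho_linear)
  show "even_rho (u + w) v = even_rho u v + even_rho w v"
    "even_rho (u - w) v = even_rho u v - even_rho w v"
    "even_rho (fscale c u) v = scaleV c (even_rho u v)" "even_rho 0 v = 0"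
    by (simp_all add: l.add l.diff l.scale l.zero)
qed

lemma even_rho_symb: "even_rho (symb a b) v = half_anticomm a b v"
  unfolding even_rho_def by (simp add: fext_symb V.vector_space_axioms)

lemma even_rho_End: "Vector_Spaces.linear scaleV scaleV (even_rho u)"
proof -
  have "even_rho u (v + w) = even_rho u v + even_rho u w" for v w
    by (simp add: even_rho_def fext_def half_anticomm_def rho_simps split_def sum.distrib[symmetric]
        V.scale_right_distrib algebra_simps)
  moreover have "even_rho u (scaleV c v) = scaleV c (even_rho u v)" for c v
    by (simp add: even_rho_def fext_def half_anticomm_def rho_simps split_def V.scale_sum_right
        V.scale_right_distrib algebra_simps)
  ultimately show ?thesis
    using V.vector_space_axioms
    by (simp add: Vector_Spaces.linear_def module_hom_def module_hom_axioms_def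
        module_iff_vector_space)
qed

lemma even_rho_arg_simps:
  "even_rho u (v + w) = even_rho u v + even_rho u w"
  "even_rho u (scaleV c v) = scaleV c (even_rho u v)" "even_rho u 0 = 0"
proof -
  interpret l: Vector_Spaces.linear scaleV scaleV "even_rho u" by (rule even_rho_End)
  show "even_rho u (v + w) = even_rho u v + even_rho u w"
    "even_rho u (scaleV c v) = scaleV c (even_rho u v)" "even_rho u 0 = 0"
    by (simp_all add: l.add l.scale l.zero)
qed

text \<open>Linearity reduces this to generators of the span: bilinearity kills the tensor
  relations, symmetry and \<open>half_anticomm_invariant\<close> the two families in
  \<open>S_rels\<close>.\<close>

lemma even_rho_null:
  assumes "u \<in> A.adj_null"
  shows "even_rho u v = 0"
proof -
  interpret l: Vector_Spaces.linear fscale scaleV "\<lambda>u. even_rho u v" by (rule even_rho_linear)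
  have tens: "even_rho r v = 0" if "r \<in> A.tensor_rels" for r
    using that unfolding A.tensor_rels_def
    by (auto simp: even_rho_simps even_rho_symb half_anticomm_def rho_simps V.scale_right_distrib
        mult.commute)
  have inv: "even_rho (symb (mul a x) b - symb a (mul b x)) v = 0"
    if "a \<in> grA 1" "b \<in> grA 1" "x \<in> grA 0" for a b x
    using that by (simp add: even_rho_simps even_rho_symb half_anticomm_invariant)
  have comm: "even_rho (symb a b - symb b a) v = 0" for a b
    by (simp add: even_rho_simps even_rho_symb half_anticomm_def add.commute)
  have "even_rho r v = 0" if "r \<in> A.S_rels" for r
    using that inv comm unfolding A.S_rels_def by blast
  with tens have "even_rho r v = 0" if "r \<in> A.tensor_rels \<union> A.S_rels" for r
    using that by blast
  then show ?thesis
    using l.eq_0_on_span[of "A.tensor_rels \<union> A.S_rels" u] assms by (simp add: A.adj_null_def)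
qed

lemma even_rho_cong: "A.eqv u w \<Longrightarrow> even_rho u v = even_rho w v"
  using even_rho_null[of "u - w" v] by (simp add: A.eqv_def even_rho_simps)

lemma even_rho_gr:
  assumes "u \<in> A.free_odd" "v \<in> grV j"
  shows "even_rho u v \<in> grV j"
  using assms(1)
proof (induction u rule: A.free_odd_induct)
  case zero then show ?case by (simp add: even_rho_simps V.subspace_0 V.subspace_gr)
next
  case (add u w) then show ?case by (simp add: even_rho_simps V.subspace_add V.subspace_gr)
next
  case (scale c u) then show ?case by (simp add: even_rho_simps V.subspace_scale V.subspace_gr)
next
  case (symb a b)
  have "\<rho> p (\<rho> q v) \<in> grV j" if "p \<in> grA 1" "q \<in> grA 1" for p q
  proof -
    \<comment> \<open>Degrees live in Z/2, so two odd operators preserve parity.\<close>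
    have "1 + (1 + j) = j"
      by (cases j) simp_all
    with rho_even[OF that(1) rho_even[OF that(2) assms(2)]] show ?thesis
      by (simp only:)
  qed
  with symb have "\<rho> a (\<rho> b v) \<in> grV j" "\<rho> b (\<rho> a v) \<in> grV j"
    by blast+
  then show ?case
    by (simp add: even_rho_symb half_anticomm_def V.subspace_add V.subspace_scale V.subspace_gr)
qed

section \<open>Actions and brackets as half commutators\<close>

text \<open>On a generator \<open>symb a b\<close>, the terms of the expansion with
  \<open>\<rho> c\<close> in the middle cancel; those with \<open>\<rho> c\<close> at either end
  form the commutator.\<close>

lemma rho_act:
  assumes "u \<in> A.free_odd" and c: "c \<in> grA 1"
  shows "\<rho> (A.act u c) v = scaleV (1/2) (even_rho u (\<rho> c v) - \<rho> c (even_rho u v))"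
  using assms(1)
proof (induction u rule: A.free_odd_induct)
  interpret l: Vector_Spaces.linear fscale scaleA "\<lambda>u. A.act u c" by (rule A.linear_act)
  {
    case zero then show ?case by (simp add: l.zero even_rho_simps rho_simps)
  next
    case (add u w)
    then show ?case
      by (simp add: l.add even_rho_simps rho_simps V.scale_right_distrib V.scale_right_diff_distrib)
  next
    case (scale k u)
    then show ?case
      by (simp add: l.scale even_rho_simps rho_simps V.scale_right_diff_distrib mult.commute)
  next
    case (symb a b)
    then show ?case
      using c by (simp add: A.act_symb rho_simps rho_mul_odd_even rho_mul_odd_odd A.mul_closed
        even_rho_symb half_anticomm_def V.scale_right_distrib V.scale_right_diff_distrib)
  }
qed

lemma even_rho_bracket:
  assumes u: "u \<in> A.free_odd" and "w \<in> A.free_odd"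
  shows "even_rho (A.free_bracket u w) v =
    scaleV (1/2) (even_rho u (even_rho w v) - even_rho w (even_rho u v))"
  using assms(2)
proof (induction w rule: A.free_odd_induct)
  interpret l: Vector_Spaces.linear fscale fscale "A.free_bracket u" by (rule A.linear_bracket2)
  {
    case zero then show ?case by (simp add: l.zero even_rho_simps even_rho_arg_simps)
  next
    case (add w w')
    then show ?case
      by (simp add: l.add even_rho_simps even_rho_arg_simps V.scale_right_distrib
          V.scale_right_diff_distrib)
  next
    case (scale k w)
    then show ?case
      by (simp add: l.scale even_rho_simps even_rho_arg_simps V.scale_right_diff_distrib mult.commute)
  next
    case (symb c d)
    \<comment> \<open>The derivation formula for \<open>free_bracket\<close> holds only modulo
      \<open>adj_null\<close>, which \<open>even_rho\<close> does not see.\<close>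
    then have "even_rho (A.free_bracket u (symb c d)) v =
        half_anticomm (A.act u c) d v + half_anticomm c (A.act u d) v"
      using even_rho_cong[OF A.bracket_free_eqv[OF u]] by (simp add: even_rho_simps even_rho_symb)
    \<comment> \<open>Inserting \<open>rho_act\<close> leaves terms with \<open>even_rho u\<close>
      between the operators of \<open>c\<close> and \<open>d\<close>; they cancel in pairs, as in
      the Leibniz rule for commutators.\<close>
    also have "\<dots> = scaleV (1/2) (even_rho u (half_anticomm c d v) - half_anticomm c d (even_rho u v))"
      using u symb by (simp add: half_anticomm_def rho_act rho_simps even_rho_arg_simps
        V.scale_right_distrib V.scale_right_diff_distrib)
    finally show ?case by (simp add: even_rho_symb)
  }
qed

section \<open>Descent to the quotient and existence\<close>

text \<open>\<open>SOME\<close> picks a representative of the coset; \<open>adjoint_rho_cls\<close>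
  shows that the choice is immaterial.\<close>

definition adjoint_rho :: "(('a \<times> 'a) \<Rightarrow>\<^sub>0 'k) set \<times> 'a \<Rightarrow> 'v \<Rightarrow> 'v" where
  "adjoint_rho = (\<lambda>(X, y) v. even_rho (SOME u. u \<in> X) v + \<rho> y v)"

lemma adjoint_rho_cls:
  assumes "u \<in> A.free_odd"
  shows "adjoint_rho (A.cls u, y) v = even_rho u v + \<rho> y v"
proof -
  have "even_rho u v = even_rho w v" if "w \<in> A.cls u" for w
    using that by (intro even_rho_cong) (simp add: A.mem_cls A.eqv_def)
  then have "even_rho u v = even_rho (SOME w. w \<in> A.cls u) v"
    using someI[of "\<lambda>w. w \<in> A.cls u", OF A.cls_self[OF assms]] by blast
  then show ?thesis
    by (simp add: adjoint_rho_def)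
qed

lemma adjoint_carrierE:
  assumes "X \<in> lcarrier A.adjoint"
  obtains u y where "u \<in> A.free_odd" "y \<in> grA 1" "X = (A.cls u, y)"
  using assms by (auto simp: A.adjoint_def A.adj_even_iff)

lemma adjoint_homogE:
  assumes "X \<in> homog A.adjoint i"
  obtains u where "i = 0" "u \<in> A.free_odd" "X = (A.cls u, 0)"
    | y where "i = 1" "y \<in> grA 1" "X = (A.cls 0, y)"
  using assms by (cases i) (auto simp: A.adjoint_def A.adj_even_iff)

lemma adjoint_rho_is_rho_tilde: "is_rho_tilde scaleA mul grA scaleV \<rho> adjoint_rho"
  unfolding is_rho_tilde_def linear_to_End_def
proof (intro conjI ballI allI)
  fix X assume "X \<in> lcarrier A.adjoint"
  then obtain u y where X: "u \<in> A.free_odd" "y \<in> grA 1" "X = (A.cls u, y)"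
    by (rule adjoint_carrierE)
  show "Vector_Spaces.linear scaleV scaleV (adjoint_rho X)"
    using V.vector_space_axioms X
    by (simp add: Vector_Spaces.linear_def module_hom_def module_hom_axioms_def
        module_iff_vector_space adjoint_rho_cls even_rho_arg_simps rho_simps V.scale_right_distrib
        algebra_simps)
  show "adjoint_rho (lscale A.adjoint c X) v = scaleV c (adjoint_rho X v)" for c v
    using X by (simp add: A.adjoint_def A.adj_even_scale_cls adjoint_rho_cls A.free_odd_closed
        even_rho_simps rho_simps V.scale_right_distrib)
  fix Y v assume "Y \<in> lcarrier A.adjoint"
  then obtain w z where Y: "w \<in> A.free_odd" "z \<in> grA 1" "Y = (A.cls w, z)"
    by (rule adjoint_carrierE)
  show "adjoint_rho (ladd A.adjoint X Y) v = adjoint_rho X v + adjoint_rho Y v"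
    using X Y by (simp add: A.adjoint_def A.adj_even_add_cls adjoint_rho_cls A.free_odd_closed
        even_rho_simps rho_simps)
next
  show "adjoint_rho (A.odd_elem a) = \<rho> a" for a
    by (rule ext) (simp add: A.odd_elem_def adjoint_rho_cls A.free_odd_closed even_rho_simps)
next
  show "adjoint_rho (A.odot a b) v = scaleV (1/2) (\<rho> a (\<rho> b v) + \<rho> b (\<rho> a v))"
    if "a \<in> grA 1" "b \<in> grA 1" for a b v
    using that by (simp add: A.odot_def adjoint_rho_cls A.symb_free_odd even_rho_symb
        half_anticomm_def rho_simps)
qed

section \<open>Uniqueness and the representation property\<close>

text \<open>The prescribed values determine the map because the classes of symbols and the odd
  elements span the carrier. Later arguments can thus treat an arbitrary
  \<open>\<phi>\<close>.\<close>

lemma rho_tilde_cls: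
  assumes \<phi>: "is_rho_tilde scaleA mul grA scaleV \<rho> \<phi>"
    and u: "u \<in> A.free_odd" and y: "y \<in> grA 1"
  shows "\<phi> (A.cls u, y) v = even_rho u v + \<rho> y v"
proof -
  have plus: "\<phi> (A.cls (p + q), y + z) v = \<phi> (A.cls p, y) v + \<phi> (A.cls q, z) v"
    if "p \<in> A.free_odd" "q \<in> A.free_odd" "y \<in> grA 1" "z \<in> grA 1" for p q y z
  proof -
    have "(A.cls p, y) \<in> lcarrier A.adjoint" "(A.cls q, z) \<in> lcarrier A.adjoint"
      using that by (auto simp: A.adjoint_def A.adj_even_iff)
    then have "\<phi> (ladd A.adjoint (A.cls p, y) (A.cls q, z)) v = \<phi> (A.cls p, y) v + \<phi> (A.cls q, z) v"
      using \<phi> unfolding is_rho_tilde_def linear_to_End_def by blast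
    then show ?thesis
      using that by (simp add: A.adjoint_def A.adj_even_add_cls)
  qed
  have mult: "\<phi> (A.cls (fscale c p), 0) v = scaleV c (\<phi> (A.cls p, 0) v)"
    if "p \<in> A.free_odd" for p c
  proof -
    have "(A.cls p, 0) \<in> lcarrier A.adjoint"
      using that by (auto simp: A.adjoint_def A.adj_even_iff A.odd_closed)
    then have "\<phi> (lscale A.adjoint c (A.cls p, 0)) v = scaleV c (\<phi> (A.cls p, 0) v)"
      using \<phi> unfolding is_rho_tilde_def linear_to_End_def by blast
    then show ?thesis
      using that by (simp add: A.adjoint_def A.adj_even_scale_cls)
  qed
  have odd: "\<phi> (A.cls 0, z) v = \<rho> z v" if "z \<in> grA 1" for z
    using \<phi> that unfolding is_rho_tilde_def A.odd_elem_def by simp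
  \<comment> \<open>Membership is carried along because the induction hypotheses provide only the
    predicate, while \<open>plus\<close> and \<open>mult\<close> need it.\<close>
  have "u \<in> A.free_odd \<and> \<phi> (A.cls u, 0) v = even_rho u v"
    using u
  proof (induction u rule: A.free_odd_induct)
    case zero
    then show ?case by (simp add: odd A.odd_closed A.free_odd_closed even_rho_simps rho_simps)
  next
    case (add p q)
    then show ?case
      using plus[of p q 0 0] by (simp add: A.odd_closed A.free_odd_closed even_rho_simps)
  next
    case (scale c p)
    then show ?case
      using mult[of p c] by (simp add: A.free_odd_closed even_rho_simps)
  next
    case (symb a b)
    then show ?case
      using \<phi> unfolding is_rho_tilde_def A.odot_def
      by (simp add: A.symb_free_odd even_rho_symb half_anticomm_def)
  qed
  then show ?thesis
    using plus[of u 0 0 y] u y by (simp add: odd A.odd_closed A.free_odd_closed)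
qed

text \<open>The parities decide: \<open>even_rho_bracket\<close> settles two even arguments and
  \<open>rho_act\<close> the mixed cases. For two odd ones the Koszul sign turns the supercommutator
  into the anticommutator defining \<open>half_anticomm\<close>.\<close>

lemma rho_tilde_rep:
  assumes \<phi>: "is_rho_tilde scaleA mul grA scaleV \<rho> \<phi>"
  shows "lie_superalgebra_rep A.adjoint scaleV grV \<phi>"
  unfolding lie_superalgebra_rep_def
proof (intro conjI allI ballI)
  show "superspace scaleV grV"
    by (rule V.superspace_axioms)
  show "linear_to_End A.adjoint scaleV \<phi>"
    using \<phi> unfolding is_rho_tilde_def by blast
next
  fix i j X v assume X: "X \<in> homog A.adjoint i" and v: "v \<in> grV j"
  from X show "\<phi> X v \<in> grV (i + j)"
  proof (cases rule: adjoint_homogE)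
    case (1 u)
    with v show ?thesis
      using even_rho_gr[of u v j]
      by (simp only: rho_tilde_cls[OF \<phi>] A.odd_closed rho_simps add_0_left add_0_right)
  next
    case (2 y)
    with v show ?thesis
      using rho_even[of y 1 v j]
      by (simp only: rho_tilde_cls[OF \<phi>] A.free_odd_closed even_rho_simps add_0_left)
  qed
next
  fix i j X Y v assume X: "X \<in> homog A.adjoint i" and Y: "Y \<in> homog A.adjoint j"
  \<comment> \<open>\<open>lbracket\<close> evaluates every component, even at zero entries. A
    symbol with a zero entry is nonzero in the free space and vanishes only as a class.\<close>
  have null: "A.cls (symb p 0) = A.cls 0" "A.cls (symb 0 p) = A.cls 0" if "p \<in> grA 1" for p
    using A.symb_scale2[of p 0 0] A.symb_scale1[of 0 p 0] that
    by (simp_all add: A.cls_eq_iff A.symb_free_odd A.odd_closed A.free_odd_closed A.eqv_def)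
  have act0: "A.act 0 y = 0" "A.act u 0 = 0" for u y
    by (simp_all add: A.act_def fext_def A.mul_simps split_def)
  have bracket0: "A.free_bracket 0 w = 0" "A.free_bracket w 0 = 0" for w
    by (simp_all add: A.free_bracket_def fext_def split_def)
  note s = A.adjoint_def A.even_even_cls A.even_odd_cls A.adj_even_add_cls A.symb_free_odd
    A.free_odd_closed A.odd_closed A.free_bracket_closed A.act_closed null act0 bracket0
    rho_tilde_cls[OF \<phi>] koszul_def rho_simps even_rho_simps even_rho_arg_simps
  from X show "\<phi> (lbracket A.adjoint X Y) v =
      scaleV (1/2) (\<phi> X (\<phi> Y v) - scaleV (koszul i j) (\<phi> Y (\<phi> X v)))"
  proof (cases rule: adjoint_homogE)
    case (1 u)
    from Y show ?thesis
    proof (cases rule: adjoint_homogE)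
      case Y: (1 w)
      with 1 show ?thesis by (simp add: s even_rho_bracket)
    next
      case Y: (2 y)
      with 1 show ?thesis by (simp add: s rho_act)
    qed
  next
    case (2 x)
    from Y show ?thesis
    proof (cases rule: adjoint_homogE)
      case Y: (1 w)
      with 2 show ?thesis by (simp add: s rho_act V.scale_right_diff_distrib)
    next
      case Y: (2 y)
      with 2 show ?thesis by (simp add: s even_rho_symb half_anticomm_def)
    qed
  qed
qed

end

text \<open>The first two conjuncts together express well-definedness: the prescription on
  generators has exactly one linear extension, up to values off the carrier.\<close>

theorem corollary3p7:
  fixes scaleA :: "'k::real_or_complex \<Rightarrow> 'a::ab_group_add \<Rightarrow> 'a"
    and mul :: "'a \<Rightarrow> 'a \<Rightarrow> 'a"
    and grA :: "bit \<Rightarrow> 'a set"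
    and scaleV :: "'k \<Rightarrow> 'v::ab_group_add \<Rightarrow> 'v"
    and grV :: "bit \<Rightarrow> 'v set"
    and \<rho> :: "'a \<Rightarrow> 'v \<Rightarrow> 'v"
  assumes "LA_representation scaleA mul grA scaleV grV \<rho>"
  shows "(\<exists>\<phi>. is_rho_tilde scaleA mul grA scaleV \<rho> \<phi>) \<and>
    (\<forall>\<phi> \<psi>. is_rho_tilde scaleA mul grA scaleV \<rho> \<phi> \<longrightarrow> is_rho_tilde scaleA mul grA scaleV \<rho> \<psi> \<longrightarrow>
      (\<forall>X \<in> lcarrier (lie_antialgebra.adjoint scaleA mul grA). \<phi> X = \<psi> X)) \<and>
    (\<forall>\<phi>. is_rho_tilde scaleA mul grA scaleV \<rho> \<phi> \<longrightarrow>
      lie_superalgebra_rep (lie_antialgebra.adjoint scaleA mul grA) scaleV grV \<phi>)"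
proof -
  interpret LA_representation scaleA mul grA scaleV grV \<rho> by fact
  have "\<phi> X = \<psi> X"
    if "is_rho_tilde scaleA mul grA scaleV \<rho> \<phi>" "is_rho_tilde scaleA mul grA scaleV \<rho> \<psi>"
      "X \<in> lcarrier A.adjoint" for \<phi> \<psi> X
    using that(3) by (rule adjoint_carrierE) (simp add: fun_eq_iff rho_tilde_cls that(1,2))
  then show ?thesis
    using adjoint_rho_is_rho_tilde rho_tilde_rep by blast
qed

end
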